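(* Let $\Phi$ be a homogeneous Poisson point process on $\mathbb{R}^d$ with constant intensity $\rho>0$, let $\bm{x}\in\mathbb{R}^d$ be a fixed reference point, and for $l\ge1$ let $r_l$ be the Euclidean distance from $\bm{x}$ to its $l$-th nearest neighbor among the points of $\Phi$. Let $1\le n_1<n_2$ be integers and $\dot\mu=r_{n_2}/r_{n_1}$. Then $\dot\mu$ has density $$f_{\dot\mu}(t)=\frac{d\,(t^d-1)^{n_2-n_1-1}}{t^{(n_2-1)d+1}\,B(n_2-n_1,n_1)},\qquad t>1,$$ where $B(\cdot,\cdot)$ is the Beta function. Equivalently, $Z=\dot\mu^{d}-1$ follows a Beta prime distribution $\beta'(n_2-n_1,n_1)$. Moreover, for every real $k<d\,n_1$, $$\mathbb{E}[\dot\mu^k]=\frac{B(n_2-n_1,\,n_1-k/d)}{B(n_2-n_1,\,n_1)}.$$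
   Context: The Beta prime distribution $\beta'(\alpha,\beta)$ has density $z^{\alpha-1}(1+z)^{-\alpha-\beta}/B(\alpha,\beta)$ on $(0,\infty)$. *)

theory Defs
  imports "HOL-Probability.Probability"
begin

definition homogeneous_PPP :: "'m measure \<Rightarrow> ('m \<Rightarrow> 'a::euclidean_space set) \<Rightarrow> real \<Rightarrow> bool" where
  "homogeneous_PPP M Phi rho \<longleftrightarrow>
     prob_space M \<and> 0 < rho \<and>
     (\<forall>\<omega>\<in>space M. \<forall>A. bounded A \<longrightarrow> finite (Phi \<omega> \<inter> A)) \<and>
     (\<forall>A \<in> sets lborel. bounded A \<longrightarrow>
        (\<lambda>\<omega>. card (Phi \<omega> \<inter> A)) \<in> M \<rightarrow>\<^sub>M count_space UNIV \<and>
        (\<forall>k::nat. measure M {\<omega> \<in> space M. card (Phi \<omega> \<inter> A) = k} =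
            exp (- (rho * measure lborel A)) * (rho * measure lborel A) ^ k / fact k)) \<and>
     (\<forall>(I::nat set) (A::nat \<Rightarrow> 'a set). finite I \<longrightarrow>
        (\<forall>i\<in>I. A i \<in> sets lborel \<and> bounded (A i)) \<longrightarrow> disjoint_family_on A I \<longrightarrow>
        prob_space.indep_vars M (\<lambda>_. count_space UNIV) (\<lambda>i \<omega>. card (Phi \<omega> \<inter> A i)) I)"

definition nn_dist :: "'a::euclidean_space set \<Rightarrow> 'a \<Rightarrow> nat \<Rightarrow> real" where
  "nn_dist P x l = Inf {r. 0 \<le> r \<and> l \<le> card (P \<inter> cball x r)}"

definition beta_prime_density :: "real \<Rightarrow> real \<Rightarrow> real \<Rightarrow> real" where
  "beta_prime_density a b z =
     (if 0 < z then z powr (a - 1) * (1 + z) powr (- a - b) / Beta a b else 0)"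

end

theory Submission
  imports Defs
begin

text \<open>
  Let \<open>V\<^sub>l = \<rho> c r\<^sub>l\<^sup>d\<close> with \<open>c\<close> the volume of the unit ball. Since \<open>r\<^sub>l > r\<close> means that fewer than
  \<open>l\<close> points lie in the closed ball of radius \<open>r\<close>, splitting the larger of two concentric balls into
  the smaller one and an annulus gives \<open>P(V\<^sub>n\<^sub>1 > s, V\<^sub>n\<^sub>2 > t)\<close> as a double Poisson sum. The pair
  \<open>(X, X + Y)\<close>, with independent Erlang variables \<open>X\<close> and \<open>Y\<close> of rate 1 and shapes \<open>n\<^sub>1\<close> and
  \<open>n\<^sub>2 - n\<^sub>1\<close>, has the same upper orthant probabilities, hence the same law as \<open>(V\<^sub>n\<^sub>1, V\<^sub>n\<^sub>2)\<close>.
  So \<open>Z = V\<^sub>n\<^sub>2 / V\<^sub>n\<^sub>1 - 1\<close> has the law of \<open>Y / X\<close>, which is Beta prime; the density of the distance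
  ratio follows by the substitution \<open>z = t\<^sup>d - 1\<close>, and its moments are those of \<open>1 + Z\<close>.
\<close>

section \<open>Gamma, Beta prime and Erlang integrals\<close>

text \<open>The substitution \<open>v = c * u\<close> reduces this to Euler's integral. It is the
  only Gamma integral required below: the rate \<open>c\<close> is in turn \<open>1 + z\<close>,
  \<open>u\<close> and 1.\<close>

lemma nn_integral_Gamma_scaled:
  fixes s c :: real
  assumes "0 < s" "0 < c"
  shows "(\<integral>\<^sup>+u. ennreal (indicator {0<..} u * (u powr (s - 1) * exp (- (c * u)))) \<partial>lborel)
           = ennreal (Gamma s / c powr s)"
proof -
  have "(\<integral>\<^sup>+u. ennreal (indicator {0<..} u * (u powr (s - 1) * exp (- (c * u)))) \<partial>lborel)
      = ennreal \<bar>1 / c\<bar> * (\<integral>\<^sup>+u. ennreal (indicator {0<..} (0 + 1 / c * u) *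
          ((0 + 1 / c * u) powr (s - 1) * exp (- (c * (0 + 1 / c * u))))) \<partial>lborel)"
    using assms by (intro nn_integral_real_affine) auto
  \<comment> \<open>Closing the half-line at 0 changes nothing pointwise, since
    \<open>0 powr x = 0\<close>.\<close>
  also have "\<dots> = ennreal (1 / c) * (\<integral>\<^sup>+u. ennreal (1 / c powr (s - 1)) *
      ennreal (indicator {0..} u * u powr (s - 1) / exp u) \<partial>lborel)"
    using assms
    by (intro arg_cong2[where f = "(*)"] nn_integral_cong)
       (auto simp: ennreal_mult[symmetric] powr_divide exp_minus field_simps indicator_def
             split: if_splits intro!: arg_cong[where f = ennreal])
  also have "\<dots> = ennreal (1 / c) * (ennreal (1 / c powr (s - 1)) * ennreal (Gamma s))"
    by (subst nn_integral_cmult) (auto simp: Gamma_conv_nn_integral_real[OF assms(1)])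
  also have "\<dots> = ennreal (Gamma s / c powr s)"
    using assms by (simp add: ennreal_mult[symmetric] Gamma_real_pos less_imp_le powr_diff)
  finally show ?thesis .
qed

text \<open>Writing \<open>Gamma (a + b) * (1 + z) powr (- a - b)\<close> as a Gamma integral of
  rate \<open>1 + z\<close> in \<open>u\<close> gives a double integral. In the other order the
  integral over \<open>z\<close> is a Gamma integral of rate \<open>u\<close>, and what remains is
  the one for \<open>Gamma b\<close>.\<close>

lemma nn_integral_beta_prime_kernel:
  fixes a b :: real
  assumes "0 < a" "0 < b"
  shows "(\<integral>\<^sup>+z. ennreal (indicator {0<..} z * (z powr (a - 1) * (1 + z) powr (- a - b))) \<partial>lborel)
           = ennreal (Beta a b)"
proof -
  let ?I = "\<integral>\<^sup>+z. ennreal (indicator {0<..} z * (z powr (a - 1) * (1 + z) powr (- a - b))) \<partial>lborel"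
  let ?k = "\<lambda>z u. ennreal (indicator {0<..} z * z powr (a - 1)) *
              ennreal (indicator {0<..} u * (u powr (a + b - 1) * exp (- ((1 + z) * u))))"
  have "ennreal (Gamma (a + b)) * ?I = (\<integral>\<^sup>+z. ennreal (Gamma (a + b)) *
      ennreal (indicator {0<..} z * (z powr (a - 1) * (1 + z) powr (- a - b))) \<partial>lborel)"
    by (intro nn_integral_cmult[symmetric]) auto
  also have "\<dots> = (\<integral>\<^sup>+z. \<integral>\<^sup>+u. ?k z u \<partial>lborel \<partial>lborel)"
  proof (intro nn_integral_cong)
    fix z :: real
    show "ennreal (Gamma (a + b)) *
        ennreal (indicator {0<..} z * (z powr (a - 1) * (1 + z) powr (- a - b)))
        = (\<integral>\<^sup>+u. ?k z u \<partial>lborel)"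
    proof (cases "0 < z")
      case True
      have "(\<integral>\<^sup>+u. ?k z u \<partial>lborel) = ennreal (z powr (a - 1)) *
          ennreal (Gamma (a + b) / (1 + z) powr (a + b))"
        using True assms
        by (subst nn_integral_cmult) (auto simp: nn_integral_Gamma_scaled)
      also have "\<dots> = ennreal (Gamma (a + b)) *
          ennreal (indicator {0<..} z * (z powr (a - 1) * (1 + z) powr (- a - b)))"
        using True assms
        using powr_minus_divide[of "1 + z" "a + b"]
        by (simp add: ennreal_mult[symmetric] Gamma_real_pos less_imp_le)
      finally show ?thesis by simp
    qed auto
  qed
  also have "\<dots> = (\<integral>\<^sup>+u. \<integral>\<^sup>+z. ?k z u \<partial>lborel \<partial>lborel)"
    by (intro lborel_pair.Fubini') simp
  also have "\<dots> = (\<integral>\<^sup>+u. ennreal (Gamma a) *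
      ennreal (indicator {0<..} u * (u powr (b - 1) * exp (- (1 * u)))) \<partial>lborel)"
  proof (intro nn_integral_cong)
    fix u :: real
    show "(\<integral>\<^sup>+z. ?k z u \<partial>lborel) = ennreal (Gamma a) *
      ennreal (indicator {0<..} u * (u powr (b - 1) * exp (- (1 * u))))"
    proof (cases "0 < u")
      case True
      have "(\<integral>\<^sup>+z. ?k z u \<partial>lborel) = (\<integral>\<^sup>+z. ennreal (u powr (a + b - 1) * exp (- u)) *
          ennreal (indicator {0<..} z * (z powr (a - 1) * exp (- (u * z)))) \<partial>lborel)"
        using True
        by (intro nn_integral_cong)
           (auto simp: ennreal_mult[symmetric] algebra_simps exp_add[symmetric])
      also have "\<dots> = ennreal (u powr (a + b - 1) * exp (- u)) * ennreal (Gamma a / u powr a)"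
        using True assms by (subst nn_integral_cmult) (auto simp: nn_integral_Gamma_scaled)
      also have "\<dots> = ennreal (Gamma a) *
          ennreal (indicator {0<..} u * (u powr (b - 1) * exp (- (1 * u))))"
        using True assms
        by (simp add: ennreal_mult[symmetric] Gamma_real_pos less_imp_le powr_diff powr_add
             field_simps)
      finally show ?thesis .
    qed auto
  qed
  also have "\<dots> = ennreal (Gamma a) * ennreal (Gamma b)"
    using assms nn_integral_Gamma_scaled[of b 1] by (subst nn_integral_cmult) auto
  also have "\<dots> = ennreal (Gamma (a + b)) * ennreal (Beta a b)"
    using assms Gamma_real_pos[of "a + b"]
    by (simp add: ennreal_mult'[symmetric] less_imp_le Beta_def less_imp_neq[symmetric] Gamma_real_nonneg)
  finally have "ennreal (Gamma (a + b)) * ?I = ennreal (Gamma (a + b)) * ennreal (Beta a b)" .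
  \<comment> \<open>Cancellation in \<open>ennreal\<close> requires a factor that is neither zero
    nor infinite.\<close>
  moreover have "Gamma (a + b) > 0" using assms by (simp add: Gamma_real_pos)
  ultimately show ?thesis
    by (subst (asm) ennreal_mult_cancel_left) auto
qed

lemma Beta_real_pos: "0 < Beta a b" if "0 < a" "0 < b" for a b :: real
  using that by (simp add: Beta_def Gamma_real_pos)

lemma borel_measurable_beta_prime_density[measurable]: "beta_prime_density a b \<in> borel_measurable borel"
  unfolding beta_prime_density_def[abs_def] by measurable

text \<open>The extra power only replaces \<open>b\<close> by \<open>b - p\<close> in the kernel;
  \<open>p < b\<close> is convergence at infinity.\<close>

lemma nn_integral_beta_prime_powr:
  fixes a b p :: real
  assumes "0 < a" "0 < b" "p < b"
  shows "(\<integral>\<^sup>+z. ennreal (beta_prime_density a b z) * ennreal ((1 + z) powr p) \<partial>lborel)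
           = ennreal (Beta a (b - p) / Beta a b)"
proof -
  have "(\<integral>\<^sup>+z. ennreal (beta_prime_density a b z) * ennreal ((1 + z) powr p) \<partial>lborel)
     = (\<integral>\<^sup>+z. ennreal (1 / Beta a b) * ennreal (indicator {0<..} z *
         (z powr (a - 1) * (1 + z) powr (- a - (b - p)))) \<partial>lborel)"
    using assms Beta_real_pos[of a b]
    by (intro nn_integral_cong)
       (auto simp: algebra_simps beta_prime_density_def ennreal_mult'[symmetric] powr_add[symmetric]
          intro!: arg_cong[where f = ennreal])
  also have "\<dots> = ennreal (1 / Beta a b) * ennreal (Beta a (b - p))"
    using assms by (subst nn_integral_cmult) (auto simp: nn_integral_beta_prime_kernel)
  finally show ?thesis
    using assms Beta_real_pos[of a b] by (simp add: ennreal_mult'[symmetric])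
qed

text \<open>For fixed \<open>u\<close> the substitution \<open>w = u * z\<close> contributes the
  Jacobian \<open>u\<close>; swapping the integrals then leaves a Gamma integral in
  \<open>u\<close>. The index of \<open>erlang_density\<close> is the shape minus one, which
  explains the \<open>Suc\<close> in the Beta prime parameters.\<close>

lemma nn_integral_erlang_ratio:
  assumes [measurable]: "H \<in> borel_measurable borel"
  shows "(\<integral>\<^sup>+u. ennreal (erlang_density k 1 u) *
            (\<integral>\<^sup>+w. ennreal (erlang_density m 1 w) * H (w / u) \<partial>lborel) \<partial>lborel)
       = (\<integral>\<^sup>+z. ennreal (beta_prime_density (real (Suc m)) (real (Suc k)) z) * H z \<partial>lborel)"
proof -
  let ?f = "\<lambda>u z. ennreal (indicator {0<..} u * (u * erlang_density k 1 u * erlang_density m 1 (u * z)))"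
  \<comment> \<open>The origin is removed twice: at \<open>u = 0\<close> the quotient
    \<open>w / u\<close> is the default 0, and \<open>erlang_density 0 1 0 = 1\<close> whereas
    \<open>?f\<close> and \<open>beta_prime_density\<close> vanish there.\<close>
  have AE0: "AE u in lborel. u \<noteq> (0::real)"
    by (rule AE_lborel_singleton)
  have "(\<integral>\<^sup>+u. ennreal (erlang_density k 1 u) *
            (\<integral>\<^sup>+w. ennreal (erlang_density m 1 w) * H (w / u) \<partial>lborel) \<partial>lborel)
      = (\<integral>\<^sup>+u. \<integral>\<^sup>+z. ?f u z * H z \<partial>lborel \<partial>lborel)"
    using AE0
  proof (intro nn_integral_cong_AE, eventually_elim)
    fix u :: real
    assume "u \<noteq> 0"
    show "ennreal (erlang_density k 1 u) *
            (\<integral>\<^sup>+w. ennreal (erlang_density m 1 w) * H (w / u) \<partial>lborel)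
        = (\<integral>\<^sup>+z. ?f u z * H z \<partial>lborel)"
    proof (cases "0 < u")
      case True
      have "(\<integral>\<^sup>+w. ennreal (erlang_density m 1 w) * H (w / u) \<partial>lborel)
         = ennreal \<bar>u\<bar> * (\<integral>\<^sup>+z. ennreal (erlang_density m 1 (0 + u * z)) * H ((0 + u * z) / u) \<partial>lborel)"
        using True by (intro nn_integral_real_affine) auto
      then have "ennreal (erlang_density k 1 u) *
            (\<integral>\<^sup>+w. ennreal (erlang_density m 1 w) * H (w / u) \<partial>lborel)
         = ennreal (u * erlang_density k 1 u) *
            (\<integral>\<^sup>+z. ennreal (erlang_density m 1 (u * z)) * H z \<partial>lborel)"
        using True by (simp add: ennreal_mult mult_ac)
      also have "\<dots> = (\<integral>\<^sup>+z. ?f u z * H z \<partial>lborel)"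
        using True
        by (subst nn_integral_cmult[symmetric]) (auto simp: ennreal_mult mult_ac)
      finally show ?thesis .
    next
      case False
      then show ?thesis using \<open>u \<noteq> 0\<close> by (auto simp: erlang_density_def)
    qed
  qed
  also have "\<dots> = (\<integral>\<^sup>+z. \<integral>\<^sup>+u. ?f u z * H z \<partial>lborel \<partial>lborel)"
    by (intro lborel_pair.Fubini') measurable
  also have "\<dots> = (\<integral>\<^sup>+z. (\<integral>\<^sup>+u. ?f u z \<partial>lborel) * H z \<partial>lborel)"
    by (intro nn_integral_cong nn_integral_multc) measurable
  also have "\<dots> = (\<integral>\<^sup>+z. ennreal (beta_prime_density (real (Suc m)) (real (Suc k)) z) * H z \<partial>lborel)"
    using AE0
  proof (intro nn_integral_cong_AE, eventually_elim)
    fix z :: real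
    assume "z \<noteq> 0"
    have "(\<integral>\<^sup>+u. ?f u z \<partial>lborel) = ennreal (beta_prime_density (real (Suc m)) (real (Suc k)) z)"
    proof (cases "0 < z")
      case True
      \<comment> \<open>The two densities and the Jacobian supply the powers \<open>k\<close>,
        \<open>m\<close> and 1 of \<open>u\<close>, so the exponent \<open>k + m + 1\<close> is
        \<open>?s - 1\<close>.\<close>
      let ?s = "real (k + m + 2)"
      have "(\<integral>\<^sup>+u. ?f u z \<partial>lborel) = (\<integral>\<^sup>+u. ennreal (z ^ m / (fact k * fact m)) *
          ennreal (indicator {0<..} u * (u powr (?s - 1) * exp (- ((1 + z) * u)))) \<partial>lborel)"
      proof (intro nn_integral_cong)
        fix u :: real
        have "u powr (?s - 1) = u ^ (k + m + 1)" if "0 < u"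
        proof -
          have "?s - 1 = real (k + m + 1)" by simp
          then show ?thesis using that by (simp only: powr_realpow)
        qed
        then show "?f u z = ennreal (z ^ m / (fact k * fact m)) *
          ennreal (indicator {0<..} u * (u powr (?s - 1) * exp (- ((1 + z) * u))))"
          using True
          by (cases "0 < u")
             (auto simp: erlang_density_def ennreal_mult[symmetric] power_mult_distrib power_add
                field_simps exp_add[symmetric] mult_less_0_iff exp_minus intro!: arg_cong[where f = ennreal])
      qed
      also have "\<dots> = ennreal (z ^ m / (fact k * fact m)) * ennreal (Gamma ?s / (1 + z) powr ?s)"
        using True nn_integral_Gamma_scaled[of ?s "1 + z"] by (subst nn_integral_cmult) auto
      also have "\<dots> = ennreal (beta_prime_density (real (Suc m)) (real (Suc k)) z)"
      proof -
        have "Gamma ?s = fact (k + m + 1)"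
          using Gamma_fact[of "k + m + 1", where 'a = real] by (simp add: add_ac)
        moreover have "Beta (real (Suc m)) (real (Suc k)) = fact m * fact k / fact (k + m + 1)"
          using Gamma_fact[of "k + m + 1", where 'a = real] Gamma_fact[of m, where 'a = real]
            Gamma_fact[of k, where 'a = real]
          by (simp add: Beta_def add_ac)
        moreover have "- real (Suc m) - real (Suc k) = - ?s" by simp
        moreover have "z powr (real (Suc m) - 1) = z ^ m"
          using True by (simp add: powr_realpow)
        ultimately show ?thesis
          using True
          by (simp only: beta_prime_density_def powr_minus_divide if_True
               ennreal_mult'[symmetric] divide_nonneg_nonneg zero_le_power less_imp_le
               fact_ge_zero mult_nonneg_nonneg)
             (simp del: fact_Suc of_nat_Suc of_nat_add add: mult_ac)
      qed
      finally show ?thesis .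
    next
      case False
      then have "?f u z = 0" for u
        using \<open>z \<noteq> 0\<close> by (auto simp: erlang_density_def mult_less_0_iff indicator_def)
      then show ?thesis using False by (simp add: beta_prime_density_def)
    qed
    then show "(\<integral>\<^sup>+u. ?f u z \<partial>lborel) * H z
        = ennreal (beta_prime_density (real (Suc m)) (real (Suc k)) z) * H z"
      by simp
  qed
  finally show ?thesis .
qed

section \<open>Pairs of consecutive Erlang waiting times\<close>

text \<open>Multiplied by \<open>exp (- y)\<close> this is the Poisson distribution function of mean
  \<open>y\<close>, and also the Erlang tail of shape \<open>n + 1\<close>. Without that factor,
  differentiation merely lowers \<open>n\<close>.\<close>

definition exp_partial_sum :: "nat \<Rightarrow> real \<Rightarrow> real" where
  "exp_partial_sum n y = (\<Sum>j\<le>n. y ^ j / fact j)"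

text \<open>For a unit-rate Poisson process \<open>\<Pi>\<close>, this is \<open>P(\<Pi>(s) \<le> k, \<Pi>(t) \<le> N)\<close> when \<open>0 \<le> s \<le> t\<close> and \<open>k \<le> N\<close>.\<close>

definition erlang_pair_tail :: "nat \<Rightarrow> nat \<Rightarrow> real \<Rightarrow> real \<Rightarrow> real" where
  "erlang_pair_tail k N s t = exp (- t) * (\<Sum>i\<le>k. s ^ i / fact i * exp_partial_sum (N - i) (t - s))"

text \<open>Shape \<open>k + 1\<close> and rate 1: the waiting time for point number
  \<open>k + 1\<close> of a unit-rate Poisson process.\<close>

abbreviation erlang_measure :: "nat \<Rightarrow> real measure" where
  "erlang_measure k \<equiv> density lborel (\<lambda>x. ennreal (erlang_density k 1 x))"

lemma exp_partial_sum_nonneg: "0 \<le> y \<Longrightarrow> 0 \<le> exp_partial_sum n y"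
  by (simp add: exp_partial_sum_def sum_nonneg)

lemma exp_partial_sum_0 [simp]: "exp_partial_sum n 0 = 1"
  by (induction n) (simp_all add: exp_partial_sum_def)

lemma DERIV_power_div_fact:
  fixes x :: real
  shows "((\<lambda>x. x ^ Suc n / fact (Suc n)) has_real_derivative x ^ n / fact n) (at x)"
proof -
  have "((\<lambda>x. x ^ Suc n / fact (Suc n)) has_real_derivative (real (Suc n) * x ^ n) / fact (Suc n)) (at x)"
    by (rule DERIV_cdivide) (use DERIV_pow[of "Suc n" x] in simp)
  moreover have "(real (Suc n) * x ^ n) / fact (Suc n) = x ^ n / fact n"
    unfolding fact_Suc[of n] by (simp del: fact_Suc power_Suc of_nat_Suc)
  ultimately show ?thesis by simp
qed

lemma DERIV_exp_partial_sum_Suc: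
  "((\<lambda>y. exp_partial_sum (Suc n) y) has_real_derivative exp_partial_sum n y) (at y)"
proof (induction n)
  case 0
  then show ?case
    by (auto simp: exp_partial_sum_def intro!: derivative_eq_intros)
next
  case (Suc n)
  have "((\<lambda>y. exp_partial_sum (Suc n) y + y ^ Suc (Suc n) / fact (Suc (Suc n)))
      has_real_derivative exp_partial_sum n y + y ^ Suc n / fact (Suc n)) (at y)"
    by (intro DERIV_add[OF Suc] DERIV_power_div_fact)
  then show ?case
    by (simp add: exp_partial_sum_def)
qed

text \<open>Positivity of \<open>N\<close> matters because \<open>N - 1\<close> is truncated:
  \<open>exp_partial_sum 0\<close> is constant, with derivative 0 rather than -1.\<close>

lemma DERIV_exp_partial_sum_diff:
  assumes "0 < N"
  shows "((\<lambda>s. exp_partial_sum N (t - s)) has_real_derivative - exp_partial_sum (N - 1) (t - s)) (at s)"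
proof -
  have "((\<lambda>s. exp_partial_sum (Suc (N - 1)) (t - s)) has_real_derivative
      exp_partial_sum (N - 1) (t - s) * (0 - 1)) (at s)"
    by (rule DERIV_chain2[OF DERIV_exp_partial_sum_Suc]) (auto intro!: derivative_eq_intros)
  then show ?thesis using assms by simp
qed

text \<open>The product rule makes the derivative of the sum telescope, leaving the last term only.\<close>

lemma DERIV_poisson_pair_sum:
  assumes "k < N"
  shows "((\<lambda>s. \<Sum>i\<le>k. s ^ i / fact i * exp_partial_sum (N - i) (t - s)) has_real_derivative
      - (s ^ k / fact k * exp_partial_sum (N - Suc k) (t - s))) (at s)"
  using assms
proof (induction k)
  case 0
  then show ?case using DERIV_exp_partial_sum_diff[of N t s] by simp
next
  case (Suc k)
  have "((\<lambda>s. (\<Sum>i\<le>k. s ^ i / fact i * exp_partial_sum (N - i) (t - s))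
        + s ^ Suc k / fact (Suc k) * exp_partial_sum (N - Suc k) (t - s)) has_real_derivative
      - (s ^ k / fact k * exp_partial_sum (N - Suc k) (t - s))
      + (s ^ k / fact k * exp_partial_sum (N - Suc k) (t - s)
         + - exp_partial_sum (N - Suc k - 1) (t - s) * (s ^ Suc k / fact (Suc k)))) (at s)"
    using Suc.prems
    by (intro DERIV_add DERIV_mult Suc.IH DERIV_power_div_fact DERIV_exp_partial_sum_diff) auto
  then show ?case
    by (simp add: mult_ac del: fact_Suc power_Suc)
qed

text \<open>At the origin the tail formula says that both coordinates are almost surely
  positive.\<close>

lemma erlang_pair_tail_0 [simp]: "erlang_pair_tail k N 0 0 = 1"
proof -
  have "(\<Sum>i\<le>k. 0 ^ i / fact i) = (1 :: real)"
    using exp_partial_sum_0[of k] by (simp only: exp_partial_sum_def)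
  then show ?thesis by (simp add: erlang_pair_tail_def)
qed

lemma emeasure_erlang_greaterThan:
  "emeasure (erlang_measure m) {y<..} = ennreal (if y < 0 then 1 else exp (- y) * exp_partial_sum m y)"
proof -
  interpret D: prob_space "erlang_measure m"
    by (rule prob_space_erlang_density) simp
  have *: "emeasure (erlang_measure m) {..y} = ennreal (erlang_CDF m 1 y)"
    by (rule emeasure_erlang_density) simp
  have "{y<..} = space (erlang_measure m) - {..y}" by auto
  then have "emeasure (erlang_measure m) {y<..} = 1 - ennreal (erlang_CDF m 1 y)"
    using emeasure_compl[of "{..y}" "erlang_measure m"] D.emeasure_space_1 * by simp
  also have "\<dots> = ennreal (1 - erlang_CDF m 1 y)"
    by (metis ennreal_1 ennreal_minus erlang_CDF_nonneg zero_less_one)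
  also have "1 - erlang_CDF m 1 y = (if y < 0 then 1 else exp (- y) * exp_partial_sum m y)"
    by (simp add: erlang_CDF_def exp_partial_sum_def sum_distrib_left mult_ac)
  finally show ?thesis .
qed

text \<open>Condition on the first waiting time \<open>u\<close>. For \<open>u > t\<close> the
  second constraint holds almost surely; for \<open>s < u \<le> t\<close> it is an Erlang tail at
  \<open>t - u\<close>. The latter contribution integrates exactly, because minus the double sum is
  an antiderivative.\<close>

lemma emeasure_erlang_pair_tail:
  assumes "0 \<le> s" "s \<le> t"
  shows "emeasure (erlang_measure k \<Otimes>\<^sub>M erlang_measure m) {(u, w). s < u \<and> t < u + w}
       = ennreal (erlang_pair_tail k (k + m + 1) s t)"
proof -
  interpret D: prob_space "erlang_measure m"
    by (rule prob_space_erlang_density) simp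
  let ?P = "exp_partial_sum"
  let ?F = "\<lambda>s. \<Sum>i\<le>k. s ^ i / fact i * ?P (k + m + 1 - i) (t - s)"
  let ?h = "\<lambda>u. u ^ k / fact k * ?P m (t - u)"
  have m1: "?P m \<in> borel_measurable borel"
    unfolding exp_partial_sum_def[abs_def] by measurable
  note [measurable] = m1
  have "{(u, w). s < u \<and> t < u + w} = {p \<in> space (borel \<Otimes>\<^sub>M borel). s < fst p \<and> t < fst p + (snd p :: real)}"
    by (auto simp: space_pair_measure)
  also have "\<dots> \<in> sets (borel \<Otimes>\<^sub>M borel)" by measurable
  finally have S: "{(u, w). s < u \<and> t < u + w} \<in> sets (erlang_measure k \<Otimes>\<^sub>M erlang_measure m)"
    by (simp cong: sets_pair_measure_cong)
  have "emeasure (erlang_measure k \<Otimes>\<^sub>M erlang_measure m) {(u, w). s < u \<and> t < u + w}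
      = (\<integral>\<^sup>+u. emeasure (erlang_measure m) (Pair u -` {(u, w). s < u \<and> t < u + w}) \<partial>erlang_measure k)"
    by (rule D.emeasure_pair_measure_alt[OF S])
  also have "\<dots> = (\<integral>\<^sup>+u. indicator {s<..} u *
      ennreal (if t < u then 1 else exp (- (t - u)) * ?P m (t - u)) \<partial>erlang_measure k)"
  proof (intro nn_integral_cong)
    fix u :: real
    have "Pair u -` {(u, w). s < u \<and> t < u + w} = (if s < u then {t - u<..} else {})"
      by auto
    then show "emeasure (erlang_measure m) (Pair u -` {(u, w). s < u \<and> t < u + w})
      = indicator {s<..} u * ennreal (if t < u then 1 else exp (- (t - u)) * ?P m (t - u))"
      by (simp add: emeasure_erlang_greaterThan)
  qed
  also have "\<dots> = (\<integral>\<^sup>+u. ennreal (erlang_density k 1 u) * (indicator {s<..} u *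
      ennreal (if t < u then 1 else exp (- (t - u)) * ?P m (t - u))) \<partial>lborel)"
    by (subst nn_integral_density) auto
  \<comment> \<open>For \<open>s < u \<le> t\<close> the factors \<open>exp (- u)\<close> and
    \<open>exp (- (t - u))\<close> combine to the constant \<open>exp (- t)\<close>; including
    \<open>u = s\<close> costs a null set.\<close>
  also have "\<dots> = (\<integral>\<^sup>+u. ennreal (erlang_density k 1 u) * indicator {t<..} u
      + ennreal (exp (- t)) * (ennreal (?h u) * indicator {s..t} u) \<partial>lborel)"
    using AE_lborel_singleton[of s]
  proof (intro nn_integral_cong_AE, eventually_elim)
    fix u assume "u \<noteq> s"
    have "erlang_density k 1 u * (exp (- (t - u)) * ?P m (t - u)) = exp (- t) * ?h u" if "0 \<le> u"
      using that by (simp add: erlang_density_def exp_diff exp_minus field_simps)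
    then show "ennreal (erlang_density k 1 u) * (indicator {s<..} u *
          ennreal (if t < u then 1 else exp (- (t - u)) * ?P m (t - u)))
        = ennreal (erlang_density k 1 u) * indicator {t<..} u
          + ennreal (exp (- t)) * (ennreal (?h u) * indicator {s..t} u)"
      using assms \<open>u \<noteq> s\<close>
      by (auto simp: indicator_def ennreal_mult[symmetric] exp_partial_sum_nonneg)
  qed
  also have "\<dots> = emeasure (erlang_measure k) {t<..} +
      ennreal (exp (- t)) * (\<integral>\<^sup>+u. ennreal (?h u) * indicator {s..t} u \<partial>lborel)"
    by (subst nn_integral_add) (auto simp: emeasure_density nn_integral_cmult)
  also have "(\<integral>\<^sup>+u. ennreal (?h u) * indicator {s..t} u \<partial>lborel) = ennreal (- ?F t - (- ?F s))"
  proof (rule nn_integral_FTC_Icc)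
    show "((\<lambda>s. - ?F s) has_real_derivative ?h u) (at u)" for u
      using DERIV_minus[OF DERIV_poisson_pair_sum[of k "k + m + 1" t u]] by simp
  qed (use assms in \<open>auto simp: exp_partial_sum_nonneg\<close>)
  \<comment> \<open>At the upper endpoint every \<open>exp_partial_sum _ 0\<close> is 1, so this
    value cancels the contribution of \<open>u > t\<close>.\<close>
  also have "?F t = ?P k t" by (simp add: exp_partial_sum_def[of k])
  also have "emeasure (erlang_measure k) {t<..} = ennreal (exp (- t) * ?P k t)"
    using assms by (simp add: emeasure_erlang_greaterThan)
  also have "ennreal (exp (- t) * ?P k t) + ennreal (exp (- t)) * ennreal (- ?P k t - (- ?F s))
      = ennreal (exp (- t) * ?F s)"
  proof -
    \<comment> \<open>\<open>ennreal\<close> sends negative reals to 0, so the difference must be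
      known to be nonnegative before the terms can be added as reals.\<close>
    have "?P k t \<le> ?F s"
    proof -
      have "- ?F s \<le> - ?F t"
      proof (rule DERIV_nonneg_imp_nondecreasing[OF assms(2)])
        fix u assume "s \<le> u" "u \<le> t"
        then show "\<exists>y. ((\<lambda>s. - ?F s) has_real_derivative y) (at u) \<and> 0 \<le> y"
          using DERIV_minus[OF DERIV_poisson_pair_sum[of k "k + m + 1" t u]] assms
          by (intro exI[of _ "?h u"]) (auto simp: exp_partial_sum_nonneg)
      qed
      then show ?thesis by (simp add: exp_partial_sum_def[of k])
    qed
    then show ?thesis
      using assms
      by (simp add: ennreal_mult[symmetric] ennreal_plus[symmetric] exp_partial_sum_nonneg
          algebra_simps del: ennreal_plus)
  qed
  finally show ?thesis by (simp add: erlang_pair_tail_def)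
qed

section \<open>Identification of the joint law and of the ratio\<close>

text \<open>Upper orthants are closed under intersection and generate the Borel sets of the plane,
  so their probabilities determine the law. The tail hypothesis covers only corners with
  \<open>0 \<le> s \<le> t\<close>; positivity and \<open>V \<le> W\<close> reduce every other
  corner to such a one.\<close>

lemma (in prob_space) distr_erlang_pair:
  fixes V W :: "'a \<Rightarrow> real"
  assumes [measurable]: "V \<in> borel_measurable M" "W \<in> borel_measurable M"
    and le: "AE \<omega> in M. V \<omega> \<le> W \<omega>"
    and tail: "\<And>s t. 0 \<le> s \<Longrightarrow> s \<le> t \<Longrightarrow>
      emeasure M {\<omega> \<in> space M. s < V \<omega> \<and> t < W \<omega>} = ennreal (erlang_pair_tail k (k + m + 1) s t)"
  shows "distr M borel (\<lambda>\<omega>. (V \<omega>, W \<omega>))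
    = distr (erlang_measure k \<Otimes>\<^sub>M erlang_measure m) borel (\<lambda>(u, w). (u, u + w))"
proof -
  let ?Q = "erlang_measure k \<Otimes>\<^sub>M erlang_measure m"
  let ?E = "range (\<lambda>a :: real \<times> real. {x. eucl_less a x})"
  interpret D1: prob_space "erlang_measure k" by (rule prob_space_erlang_density) simp
  interpret D2: prob_space "erlang_measure m" by (rule prob_space_erlang_density) simp
  interpret Q: pair_prob_space "erlang_measure k" "erlang_measure m" ..
  \<comment> \<open>Stated for an arbitrary space because it serves both \<open>M\<close> and the
    Erlang product. Almost surely \<open>0 < X \<le> Y\<close>, so raising \<open>s\<close> to
    \<open>max s 0\<close> and then \<open>t\<close> to at least that value changes the event by a
    null set only.\<close>
  have red: "emeasure N {\<omega> \<in> space N. s < X \<omega> \<and> t < Y \<omega>}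
      = ennreal (erlang_pair_tail k (k + m + 1) (max s 0) (max t (max s 0)))"
    if "prob_space N" and [measurable]: "X \<in> borel_measurable N" "Y \<in> borel_measurable N"
      and XY: "AE \<omega> in N. X \<omega> \<le> Y \<omega>"
      and T: "\<And>s t. 0 \<le> s \<Longrightarrow> s \<le> t \<Longrightarrow> emeasure N {\<omega> \<in> space N. s < X \<omega> \<and> t < Y \<omega>}
          = ennreal (erlang_pair_tail k (k + m + 1) s t)"
    for N :: "'c measure" and X Y s t
  proof -
    interpret N: prob_space N by fact
    have "emeasure N {\<omega> \<in> space N. 0 < X \<omega> \<and> 0 < Y \<omega>} = 1"
      using T[of 0 0] by simp
    then have "AE \<omega> in N. 0 < X \<omega> \<and> 0 < Y \<omega>"
      by (subst N.AE_iff_emeasure_eq_1) auto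
    then have "emeasure N {\<omega> \<in> space N. s < X \<omega> \<and> t < Y \<omega>}
        = emeasure N {\<omega> \<in> space N. max s 0 < X \<omega> \<and> max t (max s 0) < Y \<omega>}"
      using XY by (intro emeasure_eq_AE) auto
    also have "\<dots> = ennreal (erlang_pair_tail k (k + m + 1) (max s 0) (max t (max s 0)))"
      by (rule T) auto
    finally show ?thesis .
  qed
  have setsQ: "sets ?Q = sets (borel \<Otimes>\<^sub>M borel)" by (intro sets_pair_measure_cong) auto
  have Qm[measurable]: "fst \<in> borel_measurable ?Q" "(\<lambda>p. fst p + snd p) \<in> borel_measurable ?Q"
    by (simp_all cong: measurable_cong_sets add: measurable_cong_sets[OF setsQ refl])
  have Qpos: "AE p in ?Q. fst p \<le> fst p + snd p"
  proof -
    have "AE w in erlang_measure m. 0 \<le> w"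
      by (subst AE_density) (auto simp: erlang_density_def)
    moreover have "{p \<in> space ?Q. fst p \<le> fst p + snd p} \<in> sets ?Q"
      using Qm by (rule borel_measurable_le)
    ultimately show ?thesis
      by (intro Q.AE_pair_measure) auto
  qed
  have Qp: "(\<lambda>(u, w). (u, u + w)) \<in> ?Q \<rightarrow>\<^sub>M borel"
    unfolding borel_prod[symmetric] using Qm by (simp add: case_prod_beta)
  \<comment> \<open>\<open>borel_eq_greaterThan\<close> describes the generator through
    \<open>eucl_less\<close>, the strict order in every coordinate.\<close>
  have eucl: "eucl_less (a, b) (x, y) \<longleftrightarrow> a < x \<and> b < y" for a b x y :: real
    by (auto simp: eucl_less_def Basis_prod_def)
  have eq: "emeasure (distr M borel (\<lambda>\<omega>. (V \<omega>, W \<omega>))) X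
      = emeasure (distr ?Q borel (\<lambda>(u, w). (u, u + w))) X" if "X \<in> ?E" for X
  proof -
    from that obtain a where "X = {x. eucl_less a x}" by blast
    then obtain s t where X: "X = {x. eucl_less (s, t) x}" by (cases a) blast
    have Xb: "X \<in> sets borel" unfolding X by (simp add: borel_eq_greaterThan)
    have "emeasure (distr M borel (\<lambda>\<omega>. (V \<omega>, W \<omega>))) X = emeasure M {\<omega> \<in> space M. s < V \<omega> \<and> t < W \<omega>}"
      using Xb by (subst emeasure_distr) (auto simp: X eucl intro!: arg_cong[where f = "emeasure M"])
    also have "\<dots> = ennreal (erlang_pair_tail k (k + m + 1) (max s 0) (max t (max s 0)))"
      by (rule red[OF prob_space_axioms _ _ le tail]) auto
    also have "\<dots> = emeasure ?Q {p \<in> space ?Q. s < fst p \<and> t < fst p + snd p}"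
    proof (rule red[symmetric, OF _ _ _ Qpos])
      show "prob_space ?Q" by (rule Q.prob_space_axioms)
      fix s t :: real assume "0 \<le> s" "s \<le> t"
      then show "emeasure ?Q {p \<in> space ?Q. s < fst p \<and> t < fst p + snd p}
          = ennreal (erlang_pair_tail k (k + m + 1) s t)"
        using emeasure_erlang_pair_tail[of s t k m]
        by (simp add: space_pair_measure case_prod_unfold)
    qed (use Qm in auto)
    also have "\<dots> = emeasure (distr ?Q borel (\<lambda>(u, w). (u, u + w))) X"
      using Xb Qp by (subst emeasure_distr)
        (auto simp: X eucl intro!: arg_cong[where f = "emeasure ?Q"])
    finally show ?thesis .
  qed
  show ?thesis
  proof (rule measure_eqI_generator_eq[where E = ?E and \<Omega> = UNIV
        and A = "\<lambda>n. {x. eucl_less (- real n, - real n) x}"])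
    show "Int_stable ?E"
    proof (rule Int_stableI, clarify)
      fix a b c d :: real
      have "{x. eucl_less (a, b) x} \<inter> {x. eucl_less (c, d) x} = {x. eucl_less (max a c, max b d) x}"
        by (auto simp: eucl)
      then show "{x. eucl_less (a, b) x} \<inter> {x. eucl_less (c, d) x} \<in> ?E" by blast
    qed
    show "(\<Union>n. {x. eucl_less (- real n, - real n) x}) = UNIV"
    proof safe
      fix a b :: real
      obtain n where "max (- a) (- b) < real n" using reals_Archimedean2 by blast
      then show "(a, b) \<in> (\<Union>n. {x. eucl_less (- real n, - real n) x})"
        by (auto simp: eucl intro!: exI[of _ n])
    qed auto
    show "emeasure (distr M borel (\<lambda>\<omega>. (V \<omega>, W \<omega>))) {x. eucl_less (- real n, - real n) x} \<noteq> \<infinity>" for n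
    proof -
      have "(\<lambda>\<omega>. (V \<omega>, W \<omega>)) \<in> M \<rightarrow>\<^sub>M borel"
        unfolding borel_prod[symmetric] by measurable
      then interpret D: prob_space "distr M borel (\<lambda>\<omega>. (V \<omega>, W \<omega>))"
        by (rule prob_space_distr)
      show ?thesis by simp
    qed
  qed (use eq in \<open>auto simp: borel_eq_greaterThan\<close>)
qed

text \<open>The quantity \<open>W / V - 1\<close> is a Borel function of the pair, so its law may be
  computed on the Erlang model \<open>(u, u + w)\<close>, where it becomes
  \<open>w / u\<close>.\<close>

lemma (in prob_space) distributed_beta_prime_erlang_ratio:
  fixes V W :: "'a \<Rightarrow> real"
  assumes [measurable]: "V \<in> borel_measurable M" "W \<in> borel_measurable M"
    and le: "AE \<omega> in M. V \<omega> \<le> W \<omega>"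
    and tail: "\<And>s t. 0 \<le> s \<Longrightarrow> s \<le> t \<Longrightarrow>
      emeasure M {\<omega> \<in> space M. s < V \<omega> \<and> t < W \<omega>} = ennreal (erlang_pair_tail k (k + m + 1) s t)"
  shows "distributed M lborel (\<lambda>\<omega>. W \<omega> / V \<omega> - 1)
    (\<lambda>z. ennreal (beta_prime_density (real (Suc m)) (real (Suc k)) z))"
  unfolding distributed_def
proof (intro conjI)
  let ?Q = "erlang_measure k \<Otimes>\<^sub>M erlang_measure m"
  let ?g = "\<lambda>(v, w). w / v - 1 :: real"
  interpret D2: prob_space "erlang_measure m" by (rule prob_space_erlang_density) simp
  have g[measurable]: "?g \<in> borel_measurable borel"
    unfolding borel_prod[symmetric] by measurable
  have setsQ: "sets ?Q = sets (borel \<Otimes>\<^sub>M borel)" by (intro sets_pair_measure_cong) auto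
  have Qp: "(\<lambda>(u, w). (u, u + w)) \<in> ?Q \<rightarrow>\<^sub>M borel"
    unfolding borel_prod[symmetric] by (simp add: measurable_cong_sets[OF setsQ refl])
  show "distr M lborel (\<lambda>\<omega>. W \<omega> / V \<omega> - 1)
      = density lborel (\<lambda>z. ennreal (beta_prime_density (real (Suc m)) (real (Suc k)) z))"
  proof (rule measure_eqI)
    fix A assume "A \<in> sets (distr M lborel (\<lambda>\<omega>. W \<omega> / V \<omega> - 1))"
    then have A[measurable]: "A \<in> sets borel" by simp
    have pair: "(\<lambda>\<omega>. (V \<omega>, W \<omega>)) \<in> M \<rightarrow>\<^sub>M borel"
      unfolding borel_prod[symmetric] by measurable
    have "emeasure (distr M lborel (\<lambda>\<omega>. W \<omega> / V \<omega> - 1)) A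
        = (\<integral>\<^sup>+\<omega>. indicator A (W \<omega> / V \<omega> - 1) \<partial>M)"
      using nn_integral_distr[of "\<lambda>\<omega>. W \<omega> / V \<omega> - 1" M lborel "indicator A"] by simp
    also have "\<dots> = (\<integral>\<^sup>+p. indicator A (?g p) \<partial>distr M borel (\<lambda>\<omega>. (V \<omega>, W \<omega>)))"
      using pair by (subst nn_integral_distr) auto
    also have "\<dots> = (\<integral>\<^sup>+p. indicator A (?g p) \<partial>distr ?Q borel (\<lambda>(u, w). (u, u + w)))"
      using distr_erlang_pair[OF _ _ le tail] by simp
    also have "\<dots> = (\<integral>\<^sup>+p. indicator A ((fst p + snd p) / fst p - 1) \<partial>?Q)"
      using g by (subst nn_integral_distr[OF Qp]) (auto simp: case_prod_beta[abs_def])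
    also have "\<dots> = (\<integral>\<^sup>+u. \<integral>\<^sup>+w. indicator A ((u + w) / u - 1) \<partial>erlang_measure m \<partial>erlang_measure k)"
      by (subst D2.nn_integral_fst[symmetric])
         (simp_all add: measurable_cong_sets[OF setsQ refl])
    also have "\<dots> = (\<integral>\<^sup>+u. ennreal (erlang_density k 1 u) *
            (\<integral>\<^sup>+w. ennreal (erlang_density m 1 w) * indicator A ((u + w) / u - 1) \<partial>lborel) \<partial>lborel)"
      by (simp add: nn_integral_density)
    \<comment> \<open>The simplification to \<open>w / u\<close> fails at \<open>u = 0\<close>,
      where division by zero gives -1 on one side and 0 on the other.\<close>
    also have "\<dots> = (\<integral>\<^sup>+u. ennreal (erlang_density k 1 u) *
            (\<integral>\<^sup>+w. ennreal (erlang_density m 1 w) * indicator A (w / u) \<partial>lborel) \<partial>lborel)"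
      using AE_lborel_singleton[of "0::real"]
      by (intro nn_integral_cong_AE, eventually_elim) (simp add: add_divide_distrib)
    also have "\<dots> = (\<integral>\<^sup>+z. ennreal (beta_prime_density (real (Suc m)) (real (Suc k)) z) * indicator A z \<partial>lborel)"
      by (rule nn_integral_erlang_ratio) measurable
    finally show "emeasure (distr M lborel (\<lambda>\<omega>. W \<omega> / V \<omega> - 1)) A
      = emeasure (density lborel (\<lambda>z. ennreal (beta_prime_density (real (Suc m)) (real (Suc k)) z))) A"
      by (simp add: emeasure_density)
  qed simp
qed auto

section \<open>Nearest-neighbour distances\<close>

text \<open>Local finiteness leaves only finitely many distances in the interval from
  \<open>r\<close> to \<open>r + 1\<close>, so there is a gap just above \<open>r\<close>.\<close>

lemma cball_Int_right_continuous:
  fixes P :: "'a::metric_space set"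
  assumes fin: "\<And>A. bounded A \<Longrightarrow> finite (P \<inter> A)"
  obtains r' where "r < r'" "P \<inter> cball x r' = P \<inter> cball x r"
proof -
  define F where "F = dist x ` {p \<in> P \<inter> cball x (r + 1). r < dist x p}"
  have "finite F"
    unfolding F_def by (intro finite_imageI finite_subset[OF _ fin[of "cball x (r + 1)"]]) auto
  \<comment> \<open>Inserting \<open>r + 1\<close> keeps the minimum defined when \<open>F\<close>
    is empty, and keeps \<open>e\<close> inside the window that \<open>F\<close> describes.\<close>
  define e where "e = Min (insert (r + 1) F)"
  have "r < e" using \<open>finite F\<close> by (auto simp: e_def F_def)
  have e: "e \<le> r + 1" "\<And>f. f \<in> F \<Longrightarrow> e \<le> f"
    using \<open>finite F\<close> by (auto simp: e_def)
  have "P \<inter> cball x ((r + e) / 2) = P \<inter> cball x r"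
  proof (intro equalityI subsetI)
    fix p assume p: "p \<in> P \<inter> cball x ((r + e) / 2)"
    then have "dist x p < e" using \<open>r < e\<close> by simp
    then have "dist x p \<notin> F" using e by force
    then show "p \<in> P \<inter> cball x r"
      using p \<open>dist x p < e\<close> e(1) by (auto simp: F_def)
  qed (use \<open>r < e\<close> in auto)
  then show ?thesis using that[of "(r + e) / 2"] \<open>r < e\<close> by simp
qed

text \<open>Counts in closed balls are right-continuous in the radius, so too few points at
  \<open>r\<close> means too few up to some \<open>r' > r\<close>, which yields the strict
  inequality. The radius \<open>r0\<close> makes the set under the infimum nonempty.\<close>

lemma less_nn_dist_iff:
  fixes P :: "'a::euclidean_space set"
  assumes fin: "\<And>A. bounded A \<Longrightarrow> finite (P \<inter> A)"
    and ex: "0 \<le> r0" "l \<le> card (P \<inter> cball x r0)" and "0 \<le> r"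
  shows "r < nn_dist P x l \<longleftrightarrow> card (P \<inter> cball x r) < l"
proof -
  let ?S = "{r. 0 \<le> r \<and> l \<le> card (P \<inter> cball x r)}"
  have mono: "card (P \<inter> cball x a) \<le> card (P \<inter> cball x b)" if "a \<le> b" for a b
    using that by (intro card_mono fin) auto
  show ?thesis
  proof
    assume "r < nn_dist P x l"
    then show "card (P \<inter> cball x r) < l"
      using cInf_lower[of r ?S] \<open>0 \<le> r\<close> by (force simp: nn_dist_def bdd_below_def)
  next
    assume less: "card (P \<inter> cball x r) < l"
    obtain r' where r': "r < r'" "P \<inter> cball x r' = P \<inter> cball x r"
      using cball_Int_right_continuous[OF fin] by metis
    have "r' \<le> s" if "s \<in> ?S" for s
      using mono[of s r'] that less r' by (metis (mono_tags) linorder_not_le mem_Collect_eq nle_le order_trans)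
    then have "r' \<le> nn_dist P x l"
      unfolding nn_dist_def using ex by (intro cInf_greatest) auto
    then show "r < nn_dist P x l" using r' by simp
  qed
qed

lemma nn_dist_nonneg:
  assumes "0 \<le> r0" "l \<le> card (P \<inter> cball x r0)"
  shows "0 \<le> nn_dist P x l"
  unfolding nn_dist_def using assms by (intro cInf_greatest) auto

lemma nn_dist_mono:
  assumes "0 \<le> r0" "n \<le> card (P \<inter> cball x r0)" "l \<le> n"
  shows "nn_dist P x l \<le> nn_dist P x n"
  unfolding nn_dist_def using assms by (intro cInf_superset_mono) (auto simp: bdd_below_def)

section \<open>Poisson counts in concentric balls\<close>

text \<open>Split according to the value of \<open>X\<close>. Independence is assumed in the form of
  a single value against a set, exactly what this splitting uses, and the exponentials multiply to
  \<open>exp (- t)\<close>.\<close>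

lemma measure_poisson_pair_tail:
  fixes X Y :: "'m \<Rightarrow> nat"
  assumes "prob_space M"
    and [measurable]: "X \<in> M \<rightarrow>\<^sub>M count_space UNIV" "Y \<in> M \<rightarrow>\<^sub>M count_space UNIV"
    and indep: "\<And>i J. measure M {\<omega> \<in> space M. X \<omega> = i \<and> Y \<omega> \<in> J}
        = measure M {\<omega> \<in> space M. X \<omega> = i} * measure M {\<omega> \<in> space M. Y \<omega> \<in> J}"
    and X: "\<And>i. measure M {\<omega> \<in> space M. X \<omega> = i} = exp (- s) * s ^ i / fact i"
    and Y: "\<And>i. measure M {\<omega> \<in> space M. Y \<omega> = i} = exp (- (t - s)) * (t - s) ^ i / fact i"
    and "k \<le> N"
  shows "measure M {\<omega> \<in> space M. X \<omega> \<le> k \<and> X \<omega> + Y \<omega> \<le> N} = erlang_pair_tail k N s t"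
proof -
  interpret prob_space M by fact
  have Yle: "prob {\<omega> \<in> space M. Y \<omega> \<in> {..n}} = exp (- (t - s)) * exp_partial_sum n (t - s)" for n
  proof -
    have "prob {\<omega> \<in> space M. Y \<omega> \<in> {..n}} = prob (\<Union>j\<in>{..n}. {\<omega> \<in> space M. Y \<omega> = j})"
      by (intro arg_cong[where f = prob]) auto
    also have "\<dots> = (\<Sum>j\<le>n. prob {\<omega> \<in> space M. Y \<omega> = j})"
      by (intro finite_measure_finite_Union) (auto simp: disjoint_family_on_def)
    finally show ?thesis by (simp add: Y exp_partial_sum_def sum_distrib_left)
  qed
  have "prob {\<omega> \<in> space M. X \<omega> \<le> k \<and> X \<omega> + Y \<omega> \<le> N}
      = prob (\<Union>i\<in>{..k}. {\<omega> \<in> space M. X \<omega> = i \<and> Y \<omega> \<in> {..N - i}})"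
    \<comment> \<open>Since \<open>i \<le> k \<le> N\<close>, the truncated difference
      \<open>N - i\<close> is the true one.\<close>
    using \<open>k \<le> N\<close> by (intro arg_cong[where f = prob]) auto
  also have "\<dots> = (\<Sum>i\<le>k. prob {\<omega> \<in> space M. X \<omega> = i \<and> Y \<omega> \<in> {..N - i}})"
    by (intro finite_measure_finite_Union) (auto simp: disjoint_family_on_def)
  also have "\<dots> = erlang_pair_tail k N s t"
    unfolding indep X Yle erlang_pair_tail_def sum_distrib_left
    by (intro sum.cong refl) (simp add: exp_minus exp_diff field_simps)
  finally show ?thesis .
qed

locale poisson_process =
  fixes M :: "'m measure" and Phi :: "'m \<Rightarrow> 'a::euclidean_space set" and rho :: real
  assumes PPP: "homogeneous_PPP M Phi rho"
begin

sublocale prob_space M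
  using PPP by (simp add: homogeneous_PPP_def)

text \<open>The Poisson mean of the count in a unit ball, that is, the factor turning
  \<open>r ^ d\<close> into the mean for radius \<open>r\<close>.\<close>

definition ball_rate :: real where
  "ball_rate = rho * unit_ball_vol (real DIM('a))"

lemma ball_rate_pos: "0 < ball_rate"
  using PPP by (simp add: homogeneous_PPP_def ball_rate_def)

lemma finite_Int_bounded: "\<omega> \<in> space M \<Longrightarrow> bounded A \<Longrightarrow> finite (Phi \<omega> \<inter> A)"
  using PPP by (simp add: homogeneous_PPP_def)

lemma measurable_card:
  "A \<in> sets borel \<Longrightarrow> bounded A \<Longrightarrow> (\<lambda>\<omega>. card (Phi \<omega> \<inter> A)) \<in> M \<rightarrow>\<^sub>M count_space UNIV"
  using PPP by (simp add: homogeneous_PPP_def)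

lemma measurable_card_cball [measurable]:
  "(\<lambda>\<omega>. card (Phi \<omega> \<inter> cball x r)) \<in> M \<rightarrow>\<^sub>M count_space UNIV"
  by (rule measurable_card) auto

lemma prob_card:
  "A \<in> sets borel \<Longrightarrow> bounded A \<Longrightarrow> prob {\<omega> \<in> space M. card (Phi \<omega> \<inter> A) = k}
    = exp (- (rho * measure lborel A)) * (rho * measure lborel A) ^ k / fact k"
  using PPP by (simp add: homogeneous_PPP_def)

lemma rho_content_cball: "0 \<le> r \<Longrightarrow> rho * measure lborel (cball (x::'a) r) = ball_rate * r ^ DIM('a)"
  by (simp add: ball_rate_def content_cball)

lemma prob_card_indep:
  assumes "A \<in> sets borel" "bounded A" "B \<in> sets borel" "bounded B" "A \<inter> B = {}"
  shows "prob {\<omega> \<in> space M. card (Phi \<omega> \<inter> A) = i \<and> card (Phi \<omega> \<inter> B) \<in> J}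
    = prob {\<omega> \<in> space M. card (Phi \<omega> \<inter> A) = i} * prob {\<omega> \<in> space M. card (Phi \<omega> \<inter> B) \<in> J}"
proof -
  \<comment> \<open>Independence is postulated for families indexed by naturals, so the pair is
    encoded as a family over \<open>{0, 1}\<close>.\<close>
  let ?C = "\<lambda>n::nat. if n = 0 then A else B"
  let ?J = "\<lambda>n::nat. if n = 0 then {i} else J"
  let ?X = "\<lambda>n \<omega>. card (Phi \<omega> \<inter> ?C n)"
  have *: "\<forall>(I::nat set) (A::nat \<Rightarrow> 'a set). finite I \<longrightarrow>
        (\<forall>i\<in>I. A i \<in> sets lborel \<and> bounded (A i)) \<longrightarrow> disjoint_family_on A I \<longrightarrow>
        indep_vars (\<lambda>_. count_space UNIV) (\<lambda>i \<omega>. card (Phi \<omega> \<inter> A i)) I"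
    using PPP unfolding homogeneous_PPP_def by (elim conjE)
  have "indep_vars (\<lambda>_. count_space UNIV) ?X {0, 1}"
    using assms by (intro *[rule_format, of "{0, 1}" ?C]) (auto simp: disjoint_family_on_def)
  from indep_varsD_finite[OF this, of ?J]
  have "prob (\<Inter>n\<in>{0, 1}. ?X n -` ?J n \<inter> space M) = (\<Prod>n\<in>{0, 1}. prob (?X n -` ?J n \<inter> space M))"
    by simp
  moreover have "(\<Inter>n\<in>{0, 1}. ?X n -` ?J n \<inter> space M)
      = {\<omega> \<in> space M. card (Phi \<omega> \<inter> A) = i \<and> card (Phi \<omega> \<inter> B) \<in> J}"
    by auto
  moreover have "?X 0 -` ?J 0 \<inter> space M = {\<omega> \<in> space M. card (Phi \<omega> \<inter> A) = i}"
    "?X 1 -` ?J 1 \<inter> space M = {\<omega> \<in> space M. card (Phi \<omega> \<inter> B) \<in> J}"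
    by auto
  ultimately show ?thesis by simp
qed

text \<open>The ball and the annulus around it are disjoint, hence their counts are independent; the
  mean for the annulus is the difference of the two ball means.\<close>

lemma prob_card_cball_pair:
  fixes x :: 'a
  assumes "0 \<le> r" "r \<le> r'" "k \<le> N"
  shows "prob {\<omega> \<in> space M. card (Phi \<omega> \<inter> cball x r) \<le> k \<and> card (Phi \<omega> \<inter> cball x r') \<le> N}
     = erlang_pair_tail k N (ball_rate * r ^ DIM('a)) (ball_rate * r' ^ DIM('a))"
proof -
  let ?A = "cball x r" and ?B = "cball x r' - cball x r"
  have sub: "cball x r \<subseteq> cball x r'" using assms by auto
  have B: "?B \<in> sets borel" "bounded ?B" by (auto intro: bounded_subset[of "cball x r'"])
  have "measure lborel ?B = measure lborel (cball x r') - measure lborel (cball x r)"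
    using sub emeasure_bounded_finite[of "cball x r'"] by (intro measure_Diff) auto
  then have vB: "rho * measure lborel ?B = ball_rate * r' ^ DIM('a) - ball_rate * r ^ DIM('a)"
    using assms by (simp only: right_diff_distrib rho_content_cball)
  have "card (Phi \<omega> \<inter> cball x r') = card (Phi \<omega> \<inter> ?A) + card (Phi \<omega> \<inter> ?B)" if "\<omega> \<in> space M" for \<omega>
  proof -
    have "Phi \<omega> \<inter> cball x r' = (Phi \<omega> \<inter> ?A) \<union> (Phi \<omega> \<inter> ?B)" using sub by auto
    then show ?thesis
      using that B finite_Int_bounded by (simp only:) (intro card_Un_disjoint, auto)
  qed
  then have "{\<omega> \<in> space M. card (Phi \<omega> \<inter> cball x r) \<le> k \<and> card (Phi \<omega> \<inter> cball x r') \<le> N}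
      = {\<omega> \<in> space M. card (Phi \<omega> \<inter> ?A) \<le> k \<and> card (Phi \<omega> \<inter> ?A) + card (Phi \<omega> \<inter> ?B) \<le> N}"
    by auto
  also have "prob \<dots> = erlang_pair_tail k N (ball_rate * r ^ DIM('a)) (ball_rate * r' ^ DIM('a))"
  proof (rule measure_poisson_pair_tail[OF prob_space_axioms])
    show "prob {\<omega> \<in> space M. card (Phi \<omega> \<inter> ?A) = i \<and> card (Phi \<omega> \<inter> ?B) \<in> J}
      = prob {\<omega> \<in> space M. card (Phi \<omega> \<inter> ?A) = i} * prob {\<omega> \<in> space M. card (Phi \<omega> \<inter> ?B) \<in> J}" for i J
      using B by (intro prob_card_indep) auto
    show "prob {\<omega> \<in> space M. card (Phi \<omega> \<inter> ?A) = i} = exp (- (ball_rate * r ^ DIM('a)))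
        * (ball_rate * r ^ DIM('a)) ^ i / fact i" for i
      using assms prob_card[of ?A i] by (simp only: rho_content_cball) auto
    show "prob {\<omega> \<in> space M. card (Phi \<omega> \<inter> ?B) = i}
        = exp (- (ball_rate * r' ^ DIM('a) - ball_rate * r ^ DIM('a)))
          * (ball_rate * r' ^ DIM('a) - ball_rate * r ^ DIM('a)) ^ i / fact i" for i
      using prob_card[OF B] vB by simp
  qed (use B assms in \<open>auto intro: measurable_card\<close>)
  finally show ?thesis .
qed

text \<open>Fewer than \<open>l\<close> points in total implies fewer than \<open>l\<close> in each
  ball of radius \<open>n\<close>. That probability is a finite sum of Poisson weights whose mean
  tends to infinity, so it tends to 0.\<close>

lemma AE_card_cball_ge: "AE \<omega> in M. \<exists>n::nat. l \<le> card (Phi \<omega> \<inter> cball x (real n))"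
proof -
  let ?S = "{\<omega> \<in> space M. \<not> (\<exists>n::nat. l \<le> card (Phi \<omega> \<inter> cball x (real n)))}"
  let ?p = "\<lambda>n. \<Sum>i<l. (ball_rate * real n ^ DIM('a)) ^ i / exp (ball_rate * real n ^ DIM('a)) / fact i"
  have le: "prob ?S \<le> ?p n" for n
  proof -
    have "prob ?S \<le> prob (\<Union>i\<in>{..<l}. {\<omega> \<in> space M. card (Phi \<omega> \<inter> cball x (real n)) = i})"
      by (intro finite_measure_mono) (auto simp: not_le)
    also have "\<dots> = (\<Sum>i<l. prob {\<omega> \<in> space M. card (Phi \<omega> \<inter> cball x (real n)) = i})"
      by (intro finite_measure_finite_Union) (auto simp: disjoint_family_on_def)
    also have "\<dots> = ?p n"
      by (intro sum.cong refl, subst prob_card)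
         (auto simp: rho_content_cball exp_minus field_simps)
    finally show ?thesis .
  qed
  have "filterlim (\<lambda>n. ball_rate * real n ^ DIM('a)) at_top sequentially"
    using ball_rate_pos
    by (intro filterlim_tendsto_pos_mult_at_top[OF tendsto_const] filterlim_pow_at_top
          filterlim_real_sequentially) auto
  then have "?p \<longlonglongrightarrow> (\<Sum>i<l. 0 / fact i)"
    by (intro tendsto_intros filterlim_compose[OF tendsto_power_div_exp_0]) auto
  then have "prob ?S \<le> 0"
    using le by (intro LIMSEQ_le_const[where a = "prob ?S"]) (auto intro: exI[of _ 0])
  then have "prob ?S = 0" using measure_nonneg[of M ?S] by linarith
  then show ?thesis
    by (intro AE_I[of _ _ ?S]) (auto simp: emeasure_eq_measure)
qed

text \<open>On the null event of fewer than \<open>l\<close> points, the distance is the junk value \<open>Inf {}\<close>.\<close>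

lemma borel_measurable_nn_dist [measurable]: "(\<lambda>\<omega>. nn_dist (Phi \<omega>) x l) \<in> borel_measurable M"
proof (rule borel_measurableI_greater)
  fix a :: real
  \<comment> \<open>Integer radii make the existence condition countable. For negative
    \<open>a\<close> the first branch is true, in accordance with nonnegativity of the
    distance.\<close>
  have "{\<omega> \<in> space M. a < nn_dist (Phi \<omega>) x l}
      = {\<omega> \<in> space M. if \<exists>n::nat. l \<le> card (Phi \<omega> \<inter> cball x (real n))
          then 0 \<le> a \<longrightarrow> card (Phi \<omega> \<inter> cball x a) < l else a < Inf {}}"
  proof (intro Collect_cong conj_cong refl)
    fix \<omega> assume \<omega>: "\<omega> \<in> space M"
    show "a < nn_dist (Phi \<omega>) x l \<longleftrightarrow> (if \<exists>n::nat. l \<le> card (Phi \<omega> \<inter> cball x (real n))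
          then 0 \<le> a \<longrightarrow> card (Phi \<omega> \<inter> cball x a) < l else a < Inf {})"
    proof (cases "\<exists>n::nat. l \<le> card (Phi \<omega> \<inter> cball x (real n))")
      case True
      then obtain n :: nat where n: "l \<le> card (Phi \<omega> \<inter> cball x (real n))" by blast
      show ?thesis
        using True less_nn_dist_iff[OF finite_Int_bounded[OF \<omega>] _ n, of a]
          nn_dist_nonneg[OF _ n] by (cases "0 \<le> a") auto
    next
      case False
      have empty: "{r. 0 \<le> r \<and> l \<le> card (Phi \<omega> \<inter> cball x r)} = {}"
      proof safe
        fix r :: real assume r: "0 \<le> r" "l \<le> card (Phi \<omega> \<inter> cball x r)"
        obtain n :: nat where "r \<le> real n" using real_arch_simple by blast
        then have "card (Phi \<omega> \<inter> cball x r) \<le> card (Phi \<omega> \<inter> cball x (real n))"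
          by (intro card_mono finite_Int_bounded[OF \<omega>]) auto
        then show "r \<in> {}" using False r by (metis order_trans)
      qed
      show ?thesis by (simp only: nn_dist_def empty if_not_P[OF False])
    qed
  qed
  also have "\<dots> \<in> sets M" by measurable
  finally show "{\<omega> \<in> space M. a < nn_dist (Phi \<omega>) x l} \<in> sets M" .
qed

text \<open>Scaled ball volumes \<open>V l\<close> behave as arrival times of a unit-rate Poisson
  process, and the scale \<open>ball_rate\<close> cancels in the quotient. The indices stand for
  \<open>n1 = k + 1\<close> and \<open>n2 = k + m + 2\<close>.\<close>

lemma distributed_nn_dist_ratio:
  "distributed M lborel
     (\<lambda>\<omega>. (nn_dist (Phi \<omega>) x (Suc (k + Suc m)) / nn_dist (Phi \<omega>) x (Suc k)) ^ DIM('a) - 1)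
     (\<lambda>z. ennreal (beta_prime_density (real (Suc m)) (real (Suc k)) z))"
proof -
  let ?d = "DIM('a)"
  define V where "V l \<omega> = ball_rate * nn_dist (Phi \<omega>) x l ^ ?d" for l \<omega>
  have [measurable]: "V l \<in> borel_measurable M" for l
    unfolding V_def by measurable
  have "distributed M lborel (\<lambda>\<omega>. V (Suc (k + Suc m)) \<omega> / V (Suc k) \<omega> - 1)
     (\<lambda>z. ennreal (beta_prime_density (real (Suc m)) (real (Suc k)) z))"
  proof (rule distributed_beta_prime_erlang_ratio)
    show "AE \<omega> in M. V (Suc k) \<omega> \<le> V (Suc (k + Suc m)) \<omega>"
      using AE_card_cball_ge[of "Suc (k + Suc m)" x]
    proof eventually_elim
      case (elim \<omega>)
      then obtain n :: nat where n: "Suc (k + Suc m) \<le> card (Phi \<omega> \<inter> cball x (real n))" by blast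
      then have n': "Suc k \<le> card (Phi \<omega> \<inter> cball x (real n))" by simp
      show ?case
        unfolding V_def using ball_rate_pos nn_dist_mono[OF _ n] nn_dist_nonneg[OF _ n']
        by (intro mult_left_mono power_mono) auto
    qed
  next
    fix s t :: real assume st: "0 \<le> s" "s \<le> t"
    \<comment> \<open>The radius whose ball has mean count \<open>v\<close>, inverting the scaling
      in \<open>V\<close>.\<close>
    define R where "R v = root ?d (v / ball_rate)" for v
    have R0: "0 \<le> R v" if "0 \<le> v" for v
      using that ball_rate_pos by (simp add: R_def)
    have R: "ball_rate * R v ^ ?d = v" if "0 \<le> v" for v
      using that ball_rate_pos by (simp add: R_def)
    have "R s \<le> R t"
      using st ball_rate_pos by (simp add: R_def divide_right_mono)
    have V_iff: "v < V l \<omega> \<longleftrightarrow> card (Phi \<omega> \<inter> cball x (R v)) < l"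
      if "\<omega> \<in> space M" "0 \<le> v" and n: "l \<le> card (Phi \<omega> \<inter> cball x (real n))" for v l \<omega> n
    proof -
      have nn: "0 \<le> nn_dist (Phi \<omega>) x l" using nn_dist_nonneg[OF _ n] by simp
      have "v < V l \<omega> \<longleftrightarrow> ball_rate * R v ^ ?d < ball_rate * nn_dist (Phi \<omega>) x l ^ ?d"
        using R that by (simp add: V_def)
      also have "\<dots> \<longleftrightarrow> R v < nn_dist (Phi \<omega>) x l"
        using ball_rate_pos nn R0 that by (simp add: power_mono_iff flip: not_le)
      also have "\<dots> \<longleftrightarrow> card (Phi \<omega> \<inter> cball x (R v)) < l"
        using that R0 by (intro less_nn_dist_iff[OF finite_Int_bounded]) auto
      finally show ?thesis .
    qed
    \<comment> \<open>Fewer than \<open>Suc k\<close> points means at most \<open>k\<close>, and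
      likewise at most \<open>k + m + 1\<close> for the outer ball. Equivalence is only almost sure
      because \<open>V_iff\<close> presupposes enough points.\<close>
    have "AE \<omega> in M. (s < V (Suc k) \<omega> \<and> t < V (Suc (k + Suc m)) \<omega>) \<longleftrightarrow>
        (card (Phi \<omega> \<inter> cball x (R s)) \<le> k \<and> card (Phi \<omega> \<inter> cball x (R t)) \<le> k + m + 1)"
      using AE_card_cball_ge[of "Suc (k + Suc m)" x] AE_space
    proof eventually_elim
      case (elim \<omega>)
      then obtain n :: nat where n: "Suc (k + Suc m) \<le> card (Phi \<omega> \<inter> cball x (real n))" by blast
      then have n': "Suc k \<le> card (Phi \<omega> \<inter> cball x (real n))" by simp
      show ?case
        using V_iff[OF elim(2) _ n] V_iff[OF elim(2) _ n'] st by auto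
    qed
    then have "prob {\<omega> \<in> space M. s < V (Suc k) \<omega> \<and> t < V (Suc (k + Suc m)) \<omega>}
        = prob {\<omega> \<in> space M. card (Phi \<omega> \<inter> cball x (R s)) \<le> k \<and> card (Phi \<omega> \<inter> cball x (R t)) \<le> k + m + 1}"
      by (intro finite_measure_eq_AE) auto
    also have "\<dots> = erlang_pair_tail k (k + m + 1) s t"
      using st R0 \<open>R s \<le> R t\<close> by (subst prob_card_cball_pair) (auto simp: R)
    finally show "emeasure M {\<omega> \<in> space M. s < V (Suc k) \<omega> \<and> t < V (Suc (k + Suc m)) \<omega>}
        = ennreal (erlang_pair_tail k (k + m + 1) s t)"
      by (simp add: emeasure_eq_measure)
  qed measurable
  moreover have "V (Suc (k + Suc m)) \<omega> / V (Suc k) \<omega>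
      = (nn_dist (Phi \<omega>) x (Suc (k + Suc m)) / nn_dist (Phi \<omega>) x (Suc k)) ^ ?d" for \<omega>
    using ball_rate_pos by (simp add: V_def power_divide)
  ultimately show ?thesis by simp
qed

end

section \<open>Density and moments of the ratio\<close>

text \<open>Distribution functions are compared: on nonnegative values \<open>X \<le> c\<close> is
  the same as \<open>X ^ d - 1 \<le> c ^ d - 1\<close>, and substituting
  \<open>z = t ^ d - 1\<close> transforms the integral.\<close>

lemma (in prob_space) distributed_root_beta_prime:
  fixes X :: "'a \<Rightarrow> real"
  assumes [measurable]: "X \<in> borel_measurable M" and nonneg: "AE \<omega> in M. 0 \<le> X \<omega>" and "0 < d"
    and Z: "distributed M lborel (\<lambda>\<omega>. X \<omega> ^ d - 1)
        (\<lambda>z. ennreal (beta_prime_density (real (Suc m)) (real (Suc k)) z))"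
  shows "distributed M lborel X (\<lambda>t. ennreal (if 1 < t then real d * (t ^ d - 1) ^ m
            / (t ^ ((k + Suc m) * d + 1) * Beta (real (Suc m)) (real (Suc k))) else 0))"
proof -
  let ?b = "beta_prime_density (real (Suc m)) (real (Suc k))"
  let ?B = "Beta (real (Suc m)) (real (Suc k))"
  let ?f = "\<lambda>t::real. if 1 < t then real d * (t ^ d - 1) ^ m / (t ^ ((k + Suc m) * d + 1) * ?B) else 0"
  have B: "0 < ?B" by (intro Beta_real_pos) auto
  have Zle: "emeasure M {\<omega> \<in> space M. X \<omega> ^ d - 1 \<le> y} = (\<integral>\<^sup>+z. ennreal (?b z) * indicator {..y} z \<partial>lborel)" for y
    using distributed_emeasure[OF Z, of "{..y}"]
    by (simp add: vimage_def Int_def conj_commute)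
  have le: "emeasure M {\<omega> \<in> space M. X \<omega> \<le> a} = (\<integral>\<^sup>+t. ennreal (?f t) * indicator {..a} t \<partial>lborel)" for a
  proof -
    have pow: "emeasure M {\<omega> \<in> space M. X \<omega> \<le> c} = (\<integral>\<^sup>+z. ennreal (?b z) * indicator {..c ^ d - 1} z \<partial>lborel)"
      if "1 \<le> c" for c
    proof -
      have "emeasure M {\<omega> \<in> space M. X \<omega> \<le> c} = emeasure M {\<omega> \<in> space M. X \<omega> ^ d - 1 \<le> c ^ d - 1}"
      proof (intro emeasure_eq_AE)
        show "AE \<omega> in M. \<omega> \<in> {\<omega> \<in> space M. X \<omega> \<le> c} \<longleftrightarrow> \<omega> \<in> {\<omega> \<in> space M. X \<omega> ^ d - 1 \<le> c ^ d - 1}"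
          using nonneg
        proof eventually_elim
          case (elim \<omega>)
          then show ?case using power_mono_iff[of "X \<omega>" c d] that \<open>0 < d\<close> by simp
        qed
      qed auto
      then show ?thesis by (simp only: Zle)
    qed
    show ?thesis
    proof (cases "1 < a")
      case False
      \<comment> \<open>The event \<open>X \<le> 1\<close> corresponds to \<open>z \<le> 0\<close>,
        where the Beta prime density vanishes.\<close>
      have "emeasure M {\<omega> \<in> space M. X \<omega> \<le> a} \<le> emeasure M {\<omega> \<in> space M. X \<omega> \<le> 1}"
        using False by (intro emeasure_mono) auto
      also have "\<dots> = (\<integral>\<^sup>+z. 0 \<partial>(lborel :: real measure))"
        unfolding pow[of 1, simplified]
        by (intro nn_integral_cong) (auto simp: beta_prime_density_def indicator_def)
      finally have "emeasure M {\<omega> \<in> space M. X \<omega> \<le> a} = 0" by simp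
      moreover have "(\<integral>\<^sup>+t. ennreal (?f t) * indicator {..a} t \<partial>lborel) = (\<integral>\<^sup>+t. 0 \<partial>(lborel :: real measure))"
        using False by (intro nn_integral_cong) (auto simp: indicator_def)
      ultimately show ?thesis by simp
    next
      case True
      have "emeasure M {\<omega> \<in> space M. X \<omega> \<le> a} = (\<integral>\<^sup>+z. ennreal (?b z) * indicator {..a ^ d - 1} z \<partial>lborel)"
        using True by (intro pow) simp
      \<comment> \<open>The lower limit 0 is written \<open>1 ^ d - 1\<close> to display it as the
        image of \<open>t = 1\<close> under the substitution.\<close>
      also have "\<dots> = (\<integral>\<^sup>+z. ennreal (?b z) * indicator {1 ^ d - 1..a ^ d - 1} z \<partial>lborel)"
        by (intro nn_integral_cong) (auto simp: beta_prime_density_def indicator_def)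
      also have "\<dots> = (\<integral>\<^sup>+z. ennreal (?b z * indicator {1 ^ d - 1..a ^ d - 1} z) \<partial>lborel)"
        by (intro nn_integral_cong) (auto simp: indicator_def)
      also have "\<dots> = (\<integral>\<^sup>+t. ennreal (?b (t ^ d - 1) * (real d * t ^ (d - 1)) * indicator {1..a} t) \<partial>lborel)"
        using True
        by (intro nn_integral_substitution[where g = "\<lambda>t. t ^ d - 1"])
           (auto simp: set_borel_measurable_def intro!: derivative_eq_intros continuous_intros)
      also have "\<dots> = (\<integral>\<^sup>+t. ennreal (?f t) * indicator {..a} t \<partial>lborel)"
        using AE_lborel_singleton[of "1::real"]
      proof (intro nn_integral_cong_AE, eventually_elim)
        fix t :: real assume "t \<noteq> 1"
        have "?b (t ^ d - 1) * (real d * t ^ (d - 1)) = ?f t" if "1 < t"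
        proof -
          have td: "1 < t ^ d" using that \<open>0 < d\<close> by (simp add: one_less_power)
          have "(t ^ d - 1) powr (real (Suc m) - 1) = (t ^ d - 1) ^ m"
            using td by (simp add: powr_realpow)
          moreover have "(t ^ d) powr (- real (Suc m) - real (Suc k)) = 1 / (t ^ d) ^ (Suc m + Suc k)"
          proof -
            have "- real (Suc m) - real (Suc k) = - real (Suc m + Suc k)" by simp
            then show ?thesis
              using td by (simp only: powr_minus_divide powr_realpow)
          qed
          \<comment> \<open>Splitting off \<open>t ^ (d - 1)\<close> cancels the Jacobian and leaves
            the exponent of the claimed density.\<close>
          moreover have "(t ^ d) ^ (Suc m + Suc k) = t ^ ((k + Suc m) * d + 1) * t ^ (d - 1)"
            using \<open>0 < d\<close> unfolding power_mult[symmetric] power_add[symmetric]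
            by (intro arg_cong[where f = "\<lambda>n. t ^ n"]) (simp add: algebra_simps)
          ultimately show ?thesis
            using td that B by (simp add: beta_prime_density_def mult_ac del: of_nat_Suc)
        qed
        then show "ennreal (?b (t ^ d - 1) * (real d * t ^ (d - 1)) * indicator {1..a} t)
            = ennreal (?f t) * indicator {..a} t"
          using \<open>t \<noteq> 1\<close> by (cases "1 < t"; cases "t \<le> a") auto
      qed
      finally show ?thesis .
    qed
  qed
  show ?thesis
  proof (rule distributedI_borel_atMost[where g = "\<lambda>a. measure M {\<omega> \<in> space M. X \<omega> \<le> a}"])
    show "AE t in lborel. 0 \<le> ?f t"
      using B by (intro AE_I2) (auto simp: one_le_power)
    fix a :: real
    have "(\<integral>\<^sup>+t. ennreal (?f t * indicator {..a} t) \<partial>lborel)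
        = (\<integral>\<^sup>+t. ennreal (?f t) * indicator {..a} t \<partial>lborel)"
      by (intro nn_integral_cong) (auto simp: indicator_def)
    then show "(\<integral>\<^sup>+t. ennreal (?f t * indicator {..a} t) \<partial>lborel)
        = ennreal (measure M {\<omega> \<in> space M. X \<omega> \<le> a})"
      by (simp only: le[symmetric] emeasure_eq_measure)
  qed (auto simp: emeasure_eq_measure)
qed

text \<open>With \<open>Z = X ^ d - 1\<close> the moment is that of
  \<open>(1 + Z) powr (k / d)\<close>. The nonnegative integral is evaluated first; its finiteness
  then gives integrability.\<close>

lemma (in prob_space) expectation_powr_beta_prime:
  fixes X :: "'a \<Rightarrow> real"
  assumes [measurable]: "X \<in> borel_measurable M" and nonneg: "AE \<omega> in M. 0 \<le> X \<omega>" and "0 < d"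
    and Z: "distributed M lborel (\<lambda>\<omega>. X \<omega> ^ d - 1) (\<lambda>z. ennreal (beta_prime_density a b z))"
    and ab: "0 < a" "0 < b" "k < real d * b"
  shows "integrable M (\<lambda>\<omega>. X \<omega> powr k)"
    and "(\<integral>\<omega>. X \<omega> powr k \<partial>M) = Beta a (b - k / real d) / Beta a b"
proof -
  have p: "k / real d < b" using \<open>0 < d\<close> ab by (simp add: field_simps)
  then have pos: "0 \<le> Beta a (b - k / real d) / Beta a b"
    using ab by (simp add: Beta_real_pos less_imp_le)
  have "(\<integral>\<^sup>+\<omega>. ennreal (X \<omega> powr k) \<partial>M) = (\<integral>\<^sup>+\<omega>. ennreal ((1 + (X \<omega> ^ d - 1)) powr (k / real d)) \<partial>M)"
    using nonneg
  proof (intro nn_integral_cong_AE, eventually_elim)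
    case (elim \<omega>)
    then show ?case
    \<comment> \<open>At zero both sides are \<open>0 powr _ = 0\<close>, for negative exponents as
      well.\<close>
    proof (cases "X \<omega> = 0")
      case False
      then have "(X \<omega> ^ d) powr (k / real d) = X \<omega> powr k"
        using elim \<open>0 < d\<close> by (simp add: powr_realpow[symmetric] powr_powr)
      then show ?thesis by simp
    qed (use \<open>0 < d\<close> in simp)
  qed
  also have "\<dots> = (\<integral>\<^sup>+z. ennreal (beta_prime_density a b z) * ennreal ((1 + z) powr (k / real d)) \<partial>lborel)"
    by (rule distributed_nn_integral[OF Z, symmetric]) auto
  also have "\<dots> = ennreal (Beta a (b - k / real d) / Beta a b)"
    using ab p by (intro nn_integral_beta_prime_powr) auto
  finally have *: "(\<integral>\<^sup>+\<omega>. ennreal (X \<omega> powr k) \<partial>M) = ennreal (Beta a (b - k / real d) / Beta a b)" .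
  show "integrable M (\<lambda>\<omega>. X \<omega> powr k)"
    by (rule integrableI_nn_integral_finite[OF _ _ *]) auto
  show "(\<integral>\<omega>. X \<omega> powr k \<partial>M) = Beta a (b - k / real d) / Beta a b"
    using pos by (subst integral_eq_nn_integral) (auto simp: *)
qed

theorem theorem3:
  fixes M :: "'m measure" and Phi :: "'m \<Rightarrow> 'a::euclidean_space set"
    and rho :: real and x :: 'a and n1 n2 :: nat
  assumes "homogeneous_PPP M Phi rho" and "0 < rho" and "1 \<le> n1" and "n1 < n2"
  defines "d \<equiv> DIM('a)"
    and "mu \<equiv> (\<lambda>\<omega>. nn_dist (Phi \<omega>) x n2 / nn_dist (Phi \<omega>) x n1)"
  shows "distributed M lborel mu
           (\<lambda>t. ennreal (if 1 < t then real d * (t ^ d - 1) ^ (n2 - n1 - 1)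
                    / (t ^ ((n2 - 1) * d + 1) * Beta (real (n2 - n1)) (real n1)) else 0))
       \<and> distributed M lborel (\<lambda>\<omega>. mu \<omega> ^ d - 1)
           (\<lambda>z. ennreal (beta_prime_density (real (n2 - n1)) (real n1) z))
       \<and> (\<forall>k::real. k < real d * real n1 \<longrightarrow>
            integrable M (\<lambda>\<omega>. mu \<omega> powr k) \<and>
            (\<integral>\<omega>. mu \<omega> powr k \<partial>M) =
              Beta (real (n2 - n1)) (real n1 - k / real d) / Beta (real (n2 - n1)) (real n1))"
proof -
  interpret poisson_process M Phi rho by unfold_locales fact
  \<comment> \<open>Erlang indices are shapes minus one, so \<open>k = n1 - 1\<close> and
    \<open>m = n2 - n1 - 1\<close>.\<close>
  obtain k where n1: "n1 = Suc k" using \<open>1 \<le> n1\<close> by (cases n1) auto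
  obtain m where n2: "n2 = Suc (k + Suc m)"
    using \<open>n1 < n2\<close> n1 less_imp_Suc_add by (metis add_Suc add_Suc_right)
  have diff: "n2 - n1 = Suc m" "n2 - n1 - 1 = m" "n2 - 1 = k + Suc m" by (simp_all add: n1 n2)
  have meas: "mu \<in> borel_measurable M" unfolding mu_def by measurable
  have d: "0 < d" by (simp add: d_def)
  have nonneg: "AE \<omega> in M. 0 \<le> mu \<omega>"
    using AE_card_cball_ge[of n2 x]
  proof eventually_elim
    case (elim \<omega>)
    then obtain n :: nat where n: "n2 \<le> card (Phi \<omega> \<inter> cball x (real n))" by blast
    then have "n1 \<le> card (Phi \<omega> \<inter> cball x (real n))" using \<open>n1 < n2\<close> by simp
    with n show ?case
      unfolding mu_def by (intro divide_nonneg_nonneg nn_dist_nonneg[of "real n"]) auto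
  qed
  have Z: "distributed M lborel (\<lambda>\<omega>. mu \<omega> ^ d - 1)
      (\<lambda>z. ennreal (beta_prime_density (real (Suc m)) (real (Suc k)) z))"
    unfolding mu_def d_def n1 n2 by (rule distributed_nn_dist_ratio)
  show ?thesis
  proof (intro conjI allI impI)
    show "distributed M lborel mu
           (\<lambda>t. ennreal (if 1 < t then real d * (t ^ d - 1) ^ (n2 - n1 - 1)
                    / (t ^ ((n2 - 1) * d + 1) * Beta (real (n2 - n1)) (real n1)) else 0))"
      using distributed_root_beta_prime[OF meas nonneg d Z] unfolding diff(2,3) unfolding diff(1) unfolding n1 .
    show "distributed M lborel (\<lambda>\<omega>. mu \<omega> ^ d - 1)
           (\<lambda>z. ennreal (beta_prime_density (real (n2 - n1)) (real n1) z))"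
      using Z unfolding diff(1) unfolding n1 .
    fix p :: real assume "p < real d * real n1"
    then show "integrable M (\<lambda>\<omega>. mu \<omega> powr p)"
      and "(\<integral>\<omega>. mu \<omega> powr p \<partial>M) =
              Beta (real (n2 - n1)) (real n1 - p / real d) / Beta (real (n2 - n1)) (real n1)"
      using expectation_powr_beta_prime[OF meas nonneg d Z, of p] unfolding diff(1) unfolding n1 by simp_all
  qed
qed

end
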